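(* Let $n=\hat\kappa=0.114$, and let $\mathcal{L}_{ij}=\mathcal{L}_{ij}^+\cup\mathcal{L}_{ij}^-\cup\mathcal{L}_{ij}^0\subseteq\mathbb{R}^5$ be the compression set and $\check{\mathcal V},\check{\mathcal W}$ the sets defined in the context. Let $\mathcal{Y}_{ij}$ be the set of all vectors consisting of $(\pi_i,\pi_j,f_{ij},l_{ij},x_{ij},x_{ij}^+,x_{ij}^-)\in\mathbb{R}^7$ and $(\pi_i^k,\pi_j^k,f_{ij}^k,l_{ij}^k,\lambda_{ij}^k)\in\mathbb{R}^5$ for $k=-5,\dots,+5$ satisfying all of the following constraints. Linking constraints: $\sum_{k=-5}^{+5}\lambda_{ij}^k=1$, $\lambda_{ij}^k\ge0$ for all $k$; $x_{ij}^+=\sum_{k=+1}^{+5}\lambda_{ij}^k$, $x_{ij}^-=\sum_{k=-5}^{-1}\lambda_{ij}^k$; $\pi_i=\sum_{k=-5}^{+5}\pi_i^k$, $\pi_j=\sum_{k=-5}^{+5}\pi_j^k$, $f_{ij}=\sum_{k=-5}^{+5}f_{ij}^k$, $l_{ij}=\sum_{k=-5}^{+5}l_{ij}^k$; $\underline\pi_i\le\pi_i\le\bar\pi_i$, $\underline\pi_j\le\pi_j\le\bar\pi_j$, $\underline f_{ij}x_{ij}^-\le f_{ij}\le\bar f_{ij}x_{ij}^+$; $x_{ij}=x_{ij}^++x_{ij}^-$, $x_{ij}^+\in[0,1]$, $x_{ij}^-\in[0,1]$. Piece $0$: $\underline\pi_i\lambda_{ij}^0\le\pi_i^0\le\bar\pi_i\lambda_{ij}^0$,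 $\underline\pi_j\lambda_{ij}^0\le\pi_j^0\le\bar\pi_j\lambda_{ij}^0$, $f_{ij}^0=l_{ij}^0=0$. Piece $+1$: $\underline\pi_i\lambda_{ij}^{+1}\le\pi_i^{+1}\le\bar\pi_i\lambda_{ij}^{+1}$, $\underline\pi_j\lambda_{ij}^{+1}\le\pi_j^{+1}\le\bar\pi_j\lambda_{ij}^{+1}$, $\underline r_{ij}\pi_i^{+1}\le\pi_j^{+1}\le\bar r_{ij}\pi_i^{+1}$, $f_{ij}^{+1}=l_{ij}^{+1}=0$. Piece $+2$: $(\pi_j^{+2},l_{ij}^{+2},\lambda_{ij}^{+2})\in\check{\mathcal V}(H_{ij}\bar f_{ij},\underline\pi_i,\max\{\underline\pi_j,\underline\pi_i\underline r_{ij}\},\min\{\bar\pi_j,\underline\pi_i\bar r_{ij}\})$, $\pi_i^{+2}=\underline\pi_i\lambda_{ij}^{+2}$, $f_{ij}^{+2}=\bar f_{ij}\lambda_{ij}^{+2}$. Piece $+3$: $(\pi_j^{+3},l_{ij}^{+3},\lambda_{ij}^{+3})\in\check{\mathcal V}(H_{ij}\bar f_{ij},\bar\pi_i,\max\{\underline\pi_j,\bar\pi_i\underline r_{ij}\},\min\{\bar\pi_j,\bar\pi_i\bar r_{ij}\})$, $\pi_i^{+3}=\bar\pi_i\lambda_{ij}^{+3}$, $f_{ij}^{+3}=\bar f_{ij}\lambda_{ij}^{+3}$. Piece $+4$: $(\pi_i^{+4},l_{ij}^{+4},\lambda_{ij}^{+4})\in\check{\mathcal W}(H_{ij}\bar f_{ij},\underline\pi_j,\max\{\underline\pi_i,\underline\pi_j/\bar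 r_{ij}\},\min\{\bar\pi_i,\underline\pi_j/\underline r_{ij}\})$, $\pi_j^{+4}=\underline\pi_j\lambda_{ij}^{+4}$, $f_{ij}^{+4}=\bar f_{ij}\lambda_{ij}^{+4}$. Piece $+5$: $(\pi_i^{+5},l_{ij}^{+5},\lambda_{ij}^{+5})\in\check{\mathcal W}(H_{ij}\bar f_{ij},\bar\pi_j,\max\{\underline\pi_i,\bar\pi_j/\bar r_{ij}\},\min\{\bar\pi_i,\bar\pi_j/\underline r_{ij}\})$, $\pi_j^{+5}=\bar\pi_j\lambda_{ij}^{+5}$, $f_{ij}^{+5}=\bar f_{ij}\lambda_{ij}^{+5}$. Piece $-1$: $\underline\pi_i\lambda_{ij}^{-1}\le\pi_i^{-1}\le\bar\pi_i\lambda_{ij}^{-1}$, $\underline\pi_j\lambda_{ij}^{-1}\le\pi_j^{-1}\le\bar\pi_j\lambda_{ij}^{-1}$, $\underline r_{ij}\pi_j^{-1}\le\pi_i^{-1}\le\bar r_{ij}\pi_j^{-1}$, $f_{ij}^{-1}=l_{ij}^{-1}=0$. Piece $-2$: $(\pi_i^{-2},-l_{ij}^{-2},\lambda_{ij}^{-2})\in\check{\mathcal V}(-H_{ij}\underline f_{ij},\underline\pi_j,\max\{\underline\pi_i,\underline\pi_j\underline r_{ij}\},\min\{\bar\pi_i,\underline\pi_j\bar r_{ij}\})$, $\pi_j^{-2}=\underline\pi_j\lambda_{ij}^{-2}$, $f_{ij}^{-2}=\underline f_{ij}\lambda_{ij}^{-2}$. Piece $-3$: $(\pi_i^{-3},-l_{ij}^{-3},\lambda_{ij}^{-3})\in\check{\mathcal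 V}(-H_{ij}\underline f_{ij},\bar\pi_j,\max\{\underline\pi_i,\bar\pi_j\underline r_{ij}\},\min\{\bar\pi_i,\bar\pi_j\bar r_{ij}\})$, $\pi_j^{-3}=\bar\pi_j\lambda_{ij}^{-3}$, $f_{ij}^{-3}=\underline f_{ij}\lambda_{ij}^{-3}$. Piece $-4$: $(\pi_j^{-4},-l_{ij}^{-4},\lambda_{ij}^{-4})\in\check{\mathcal W}(-H_{ij}\underline f_{ij},\underline\pi_i,\max\{\underline\pi_j,\underline\pi_i/\bar r_{ij}\},\min\{\bar\pi_j,\underline\pi_i/\underline r_{ij}\})$, $\pi_i^{-4}=\underline\pi_i\lambda_{ij}^{-4}$, $f_{ij}^{-4}=\underline f_{ij}\lambda_{ij}^{-4}$. Piece $-5$: $(\pi_j^{-5},-l_{ij}^{-5},\lambda_{ij}^{-5})\in\check{\mathcal W}(-H_{ij}\underline f_{ij},\bar\pi_i,\max\{\underline\pi_j,\bar\pi_i/\bar r_{ij}\},\min\{\bar\pi_j,\bar\pi_i/\underline r_{ij}\})$, $\pi_i^{-5}=\bar\pi_i\lambda_{ij}^{-5}$, $f_{ij}^{-5}=\underline f_{ij}\lambda_{ij}^{-5}$. Then $\mathcal{Y}_{ij}$ is an extended formulation of an SOCr outer-approximation of $\mathrm{conv}(\mathcal{L}_{ij})$: the set $\mathcal{Y}_{ij}$ is SOCr, and its projection onto the coordinates $(\pi_i,\pi_j,f_{ij},l_{ij},x_{ij})$ is an SOCr set containing $\mathrm{conv}(\mathcal{L}_{ij})$.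
   Context: Data: real numbers $0<\underline{\pi}_i\le\bar{\pi}_i$, $0<\underline{\pi}_j\le\bar{\pi}_j$, $\underline{f}_{ij}<0<\bar f_{ij}$, $1<\underline r_{ij}<\bar r_{ij}$, $H_{ij}>0$, and $\hat\kappa=0.114$. Define $$\Pi_{ij} := \{(\pi_i, \pi_j) \in [\underline{\pi}_{i}, \bar{\pi}_{i}]\times [\underline{\pi}_{j}, \bar{\pi}_{j}] : \underline{r}_{ij} \le \pi_j/\pi_i \le \bar{r}_{ij}\},\quad \Pi_{ji} := \{(\pi_i, \pi_j) \in [\underline{\pi}_{i}, \bar{\pi}_{i}]\times [\underline{\pi}_{j}, \bar{\pi}_{j}] : \underline{r}_{ij} \le \pi_i/\pi_j \le \bar{r}_{ij}\},$$ $$\mathcal{L}_{ij}^+ := \{ (\pi_i, \pi_j, f_{ij}, l_{ij}, x_{ij}) \in \mathbb{R}^4 \times \{1\}: l_{ij} = H_{ij}((\pi_{j}/\pi_{i})^{\hat{\kappa}} -1) f_{ij},\ (\pi_i, \pi_j) \in \Pi_{ij},\ f_{ij} \in [0, \bar{f}_{ij}] \},$$ $$\mathcal{L}_{ij}^- := \{ (\pi_i, \pi_j, f_{ij}, l_{ij}, x_{ij}) \in \mathbb{R}^4 \times \{1\}: l_{ij} = H_{ij}((\pi_{i}/\pi_{j})^{\hat{\kappa}} -1) f_{ij},\ (\pi_i, \pi_j) \in \Pi_{ji},\ f_{ij} \in [\underline{f}_{ij}, 0] \},$$ $$\mathcal{L}_{ij}^0 := \{ (\pi_i, \pi_j, f_{ij},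 l_{ij}, x_{ij}) \in \mathbb{R}^2 \times \{0\}^3: \underline{\pi}_i \le \pi_i \le \bar{\pi}_i,\ \underline{\pi}_j \le \pi_j \le \bar{\pi}_j\}.$$ With $n=0.114$, for $a>0$, $b>0$ and $\underline x,\bar x>0$ (with $b\le\underline x$ for $\check{\mathcal V}$ and $\bar x<b$ for $\check{\mathcal W}$), define $$\check{\mathcal V}(a,b,\underline x,\bar x)=\Big\{(x,y,\lambda)\in\mathbb{R}^3_+:\exists(u,v_1,v_2)\in\mathbb{R}^3_+:\ u^2\le\lambda v_1,\ v_1^2\le\lambda v_2,\ bv_2^2\le\lambda x,\ y=a(u-\lambda),\ \underline x\lambda\le x\le\bar x\lambda,\ y\ge a\,\sigma_V\,(x-\underline x\lambda)+a((\underline x/b)^n-1)\lambda\Big\},$$ $$\check{\mathcal W}(a,b,\underline x,\bar x)=\Big\{(x,y,\lambda)\in\mathbb{R}^3_+:\exists(u,v_1,v_2,v_3)\in\mathbb{R}^4_+:\ uv_1\ge\lambda^2,\ \lambda v_2\ge v_1^2,\ \lambda v_3\ge v_2^2,\ ux\ge bv_3^2,\ y=a(u-\lambda),\ \underline x\lambda\le x\le\bar x\lambda,\ y\le a\,\sigma_W\,(x-\underline x\lambda)+a((b/\underline x)^n-1)\lambda\Big\},$$ where $\sigma_V=\frac{(\bar x/b)^n-(\underline x/b)^n}{\bar x-\underline x}$ and $\sigma_W=\frac{(b/\bar x)^n-(b/\underline x)^n}{\bar x-\underline x}$, with the convention that these are $0$ if $\underline x=\bar x$. The same formulas are used if $\underline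 x>\bar x$ (then $\lambda=0$ is forced). A convex set $Y\subseteq\mathbb{R}^n$ is second-order cone representable (SOCr) if there are $m$, an affine map $T$ and a cone $K$ that is a finite product of second-order (Lorentz) cones such that $Y=\{x\in\mathbb{R}^n:\exists w\in\mathbb{R}^m,\ T(x,w)\in K\}$. $\mathrm{conv}$ denotes convex hull. *)

theory Defs
  imports "HOL-Analysis.Analysis"
begin

text \<open>Coordinate \<open>0\<close> is the axis; \<open>lorentz_cone d\<close> is the cone in \<open>\<real>\<^bsup>d+1\<^esup>\<close>
  (only coordinates \<open>0..d\<close> of a function are read), so \<open>d = 0\<close> is the half-line.\<close>

definition lorentz_cone :: "nat \<Rightarrow> (nat \<Rightarrow> real) set" where
  "lorentz_cone d = {z. L2_set z {1..d} \<le> z 0}"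

text \<open>Affine functions on \<open>'a \<times> \<real>\<^sup>m\<close>, the elements of \<open>\<real>\<^sup>m\<close> being
  given by coordinates \<open>0..<m\<close> of a function; the other coordinates have no influence.\<close>

definition affine_form :: "nat \<Rightarrow> ('a::euclidean_space \<Rightarrow> (nat \<Rightarrow> real) \<Rightarrow> real) \<Rightarrow> bool" where
  "affine_form m \<phi> \<longleftrightarrow> (\<exists>c a b. \<forall>x w. \<phi> x w = c + a \<bullet> x + (\<Sum>j<m. b j * w j))"

text \<open>\<open>T x w k i\<close> is coordinate \<open>i\<close> of the \<open>k\<close>-th block of the affine image of \<open>(x, w)\<close>;
  \<open>K\<close> is the product of the cones \<open>lorentz_cone (d k)\<close>, \<open>k < N\<close>.\<close>

definition SOCr :: "'a::euclidean_space set \<Rightarrow> bool" where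
  "SOCr Y \<longleftrightarrow> convex Y \<and>
     (\<exists>(m::nat) (N::nat) (d::nat \<Rightarrow> nat) (T::'a \<Rightarrow> (nat \<Rightarrow> real) \<Rightarrow> nat \<Rightarrow> nat \<Rightarrow> real).
        (\<forall>k<N. \<forall>i\<le>d k. affine_form m (\<lambda>x w. T x w k i)) \<and>
        Y = {x. \<exists>w. \<forall>k<N. T x w k \<in> lorentz_cone (d k)})"

abbreviation \<kappa> :: real where
  "\<kappa> \<equiv> 0.114"

definition Pi_plus :: "real \<Rightarrow> real \<Rightarrow> real \<Rightarrow> real \<Rightarrow> real \<Rightarrow> real \<Rightarrow> (real \<times> real) set" where
  "Pi_plus pil piu pjl pju rl ru =
     {(\<pi>i, \<pi>j). \<pi>i \<in> {pil..piu} \<and> \<pi>j \<in> {pjl..pju} \<and> rl \<le> \<pi>j / \<pi>i \<and> \<pi>j / \<pi>i \<le> ru}"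

definition Pi_minus :: "real \<Rightarrow> real \<Rightarrow> real \<Rightarrow> real \<Rightarrow> real \<Rightarrow> real \<Rightarrow> (real \<times> real) set" where
  "Pi_minus pil piu pjl pju rl ru =
     {(\<pi>i, \<pi>j). \<pi>i \<in> {pil..piu} \<and> \<pi>j \<in> {pjl..pju} \<and> rl \<le> \<pi>i / \<pi>j \<and> \<pi>i / \<pi>j \<le> ru}"

type_synonym real5 = "real \<times> real \<times> real \<times> real \<times> real"

definition L_plus ::
  "real \<Rightarrow> real \<Rightarrow> real \<Rightarrow> real \<Rightarrow> real \<Rightarrow> real \<Rightarrow> real \<Rightarrow> real \<Rightarrow> real5 set" where
  "L_plus pil piu pjl pju fu rl ru H =
     {(\<pi>i, \<pi>j, f, l, x). x = 1 \<and> l = H * ((\<pi>j / \<pi>i) powr \<kappa> - 1) * f \<and>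
        (\<pi>i, \<pi>j) \<in> Pi_plus pil piu pjl pju rl ru \<and> f \<in> {0..fu}}"

definition L_minus ::
  "real \<Rightarrow> real \<Rightarrow> real \<Rightarrow> real \<Rightarrow> real \<Rightarrow> real \<Rightarrow> real \<Rightarrow> real \<Rightarrow> real5 set" where
  "L_minus pil piu pjl pju fl rl ru H =
     {(\<pi>i, \<pi>j, f, l, x). x = 1 \<and> l = H * ((\<pi>i / \<pi>j) powr \<kappa> - 1) * f \<and>
        (\<pi>i, \<pi>j) \<in> Pi_minus pil piu pjl pju rl ru \<and> f \<in> {fl..0}}"

definition L_zero :: "real \<Rightarrow> real \<Rightarrow> real \<Rightarrow> real \<Rightarrow> real5 set" where
  "L_zero pil piu pjl pju =
     {(\<pi>i, \<pi>j, f, l, x). f = 0 \<and> l = 0 \<and> x = 0 \<and>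
        pil \<le> \<pi>i \<and> \<pi>i \<le> piu \<and> pjl \<le> \<pi>j \<and> \<pi>j \<le> pju}"

definition compression_set ::
  "real \<Rightarrow> real \<Rightarrow> real \<Rightarrow> real \<Rightarrow> real \<Rightarrow> real \<Rightarrow> real \<Rightarrow> real \<Rightarrow> real \<Rightarrow> real5 set" where
  "compression_set pil piu pjl pju fl fu rl ru H =
     L_plus pil piu pjl pju fu rl ru H \<union> L_minus pil piu pjl pju fl rl ru H \<union>
     L_zero pil piu pjl pju"

definition \<sigma>V :: "real \<Rightarrow> real \<Rightarrow> real \<Rightarrow> real" where
  "\<sigma>V b xl xu =
     (if xl = xu then 0 else ((xu / b) powr \<kappa> - (xl / b) powr \<kappa>) / (xu - xl))"

definition \<sigma>W :: "real \<Rightarrow> real \<Rightarrow> real \<Rightarrow> real" where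
  "\<sigma>W b xl xu =
     (if xl = xu then 0 else ((b / xu) powr \<kappa> - (b / xl) powr \<kappa>) / (xu - xl))"

definition V_check :: "real \<Rightarrow> real \<Rightarrow> real \<Rightarrow> real \<Rightarrow> (real \<times> real \<times> real) set" where
  "V_check a b xl xu =
     {(x, y, \<mu>). 0 \<le> x \<and> 0 \<le> y \<and> 0 \<le> \<mu> \<and>
        (\<exists>u v1 v2. 0 \<le> u \<and> 0 \<le> v1 \<and> 0 \<le> v2 \<and>
           u\<^sup>2 \<le> \<mu> * v1 \<and> v1\<^sup>2 \<le> \<mu> * v2 \<and> b * v2\<^sup>2 \<le> \<mu> * x \<and>
           y = a * (u - \<mu>) \<and> xl * \<mu> \<le> x \<and> x \<le> xu * \<mu> \<and>
           y \<ge> a * \<sigma>V b xl xu * (x - xl * \<mu>) + a * ((xl / b) powr \<kappa> - 1) * \<mu>)}"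

definition W_check :: "real \<Rightarrow> real \<Rightarrow> real \<Rightarrow> real \<Rightarrow> (real \<times> real \<times> real) set" where
  "W_check a b xl xu =
     {(x, y, \<mu>). 0 \<le> x \<and> 0 \<le> y \<and> 0 \<le> \<mu> \<and>
        (\<exists>u v1 v2 v3. 0 \<le> u \<and> 0 \<le> v1 \<and> 0 \<le> v2 \<and> 0 \<le> v3 \<and>
           u * v1 \<ge> \<mu>\<^sup>2 \<and> \<mu> * v2 \<ge> v1\<^sup>2 \<and> \<mu> * v3 \<ge> v2\<^sup>2 \<and> u * x \<ge> b * v3\<^sup>2 \<and>
           y = a * (u - \<mu>) \<and> xl * \<mu> \<le> x \<and> x \<le> xu * \<mu> \<and>
           y \<le> a * \<sigma>W b xl xu * (x - xl * \<mu>) + a * ((b / xl) powr \<kappa> - 1) * \<mu>)}"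

text \<open>The superscripts \<open>k = -5, \<dots>, +5\<close>.\<close>

datatype piece = Neg5 | Neg4 | Neg3 | Neg2 | Neg1 | Zero | Pos1 | Pos2 | Pos3 | Pos4 | Pos5

lemma UNIV_piece:
  "(UNIV :: piece set) = {Neg5, Neg4, Neg3, Neg2, Neg1, Zero, Pos1, Pos2, Pos3, Pos4, Pos5}"
  by (auto intro: piece.exhaust)

instance piece :: finite
  by standard (simp add: UNIV_piece)

text \<open>A vector of the extended space \<open>\<real>\<^sup>7 \<times> (\<real>\<^bsup>11\<^esup>)\<^sup>5\<close> is
  \<open>((\<pi>\<^sub>i, \<pi>\<^sub>j, f, l, x, x\<^sup>+, x\<^sup>-), (\<pi>\<^sub>i\<^sup>k)\<^sub>k, (\<pi>\<^sub>j\<^sup>k)\<^sub>k, (f\<^sup>k)\<^sub>k, (l\<^sup>k)\<^sub>k, (\<lambda>\<^sup>k)\<^sub>k)\<close>: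
  the piece variables are grouped by kind instead of by piece.\<close>

type_synonym ext =
  "(real \<times> real \<times> real \<times> real \<times> real \<times> real \<times> real) \<times>
   (real^piece) \<times> (real^piece) \<times> (real^piece) \<times> (real^piece) \<times> (real^piece)"

definition Y_set ::
  "real \<Rightarrow> real \<Rightarrow> real \<Rightarrow> real \<Rightarrow> real \<Rightarrow> real \<Rightarrow> real \<Rightarrow> real \<Rightarrow> real \<Rightarrow> ext set" where
  "Y_set pil piu pjl pju fl fu rl ru H =
     {((\<pi>i, \<pi>j, f, l, x, xp, xm), \<pi>ik, \<pi>jk, fk, lk, \<mu>).
        \<comment> \<open>linking constraints\<close>
        (\<Sum>k\<in>UNIV. \<mu> $ k) = 1 \<and> (\<forall>k. 0 \<le> \<mu> $ k) \<and>
        xp = (\<Sum>k\<in>{Pos1, Pos2, Pos3, Pos4, Pos5}. \<mu> $ k) \<and>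
        xm = (\<Sum>k\<in>{Neg5, Neg4, Neg3, Neg2, Neg1}. \<mu> $ k) \<and>
        \<pi>i = (\<Sum>k\<in>UNIV. \<pi>ik $ k) \<and> \<pi>j = (\<Sum>k\<in>UNIV. \<pi>jk $ k) \<and>
        f = (\<Sum>k\<in>UNIV. fk $ k) \<and> l = (\<Sum>k\<in>UNIV. lk $ k) \<and>
        pil \<le> \<pi>i \<and> \<pi>i \<le> piu \<and> pjl \<le> \<pi>j \<and> \<pi>j \<le> pju \<and>
        fl * xm \<le> f \<and> f \<le> fu * xp \<and>
        x = xp + xm \<and> xp \<in> {0..1} \<and> xm \<in> {0..1} \<and>
        \<comment> \<open>piece 0\<close>
        pil * \<mu> $ Zero \<le> \<pi>ik $ Zero \<and> \<pi>ik $ Zero \<le> piu * \<mu> $ Zero \<and>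
        pjl * \<mu> $ Zero \<le> \<pi>jk $ Zero \<and> \<pi>jk $ Zero \<le> pju * \<mu> $ Zero \<and>
        fk $ Zero = 0 \<and> lk $ Zero = 0 \<and>
        \<comment> \<open>piece +1\<close>
        pil * \<mu> $ Pos1 \<le> \<pi>ik $ Pos1 \<and> \<pi>ik $ Pos1 \<le> piu * \<mu> $ Pos1 \<and>
        pjl * \<mu> $ Pos1 \<le> \<pi>jk $ Pos1 \<and> \<pi>jk $ Pos1 \<le> pju * \<mu> $ Pos1 \<and>
        rl * \<pi>ik $ Pos1 \<le> \<pi>jk $ Pos1 \<and> \<pi>jk $ Pos1 \<le> ru * \<pi>ik $ Pos1 \<and>
        fk $ Pos1 = 0 \<and> lk $ Pos1 = 0 \<and>
        \<comment> \<open>piece +2\<close>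
        (\<pi>jk $ Pos2, lk $ Pos2, \<mu> $ Pos2)
          \<in> V_check (H * fu) pil (max pjl (pil * rl)) (min pju (pil * ru)) \<and>
        \<pi>ik $ Pos2 = pil * \<mu> $ Pos2 \<and> fk $ Pos2 = fu * \<mu> $ Pos2 \<and>
        \<comment> \<open>piece +3\<close>
        (\<pi>jk $ Pos3, lk $ Pos3, \<mu> $ Pos3)
          \<in> V_check (H * fu) piu (max pjl (piu * rl)) (min pju (piu * ru)) \<and>
        \<pi>ik $ Pos3 = piu * \<mu> $ Pos3 \<and> fk $ Pos3 = fu * \<mu> $ Pos3 \<and>
        \<comment> \<open>piece +4\<close>
        (\<pi>ik $ Pos4, lk $ Pos4, \<mu> $ Pos4)
          \<in> W_check (H * fu) pjl (max pil (pjl / ru)) (min piu (pjl / rl)) \<and>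
        \<pi>jk $ Pos4 = pjl * \<mu> $ Pos4 \<and> fk $ Pos4 = fu * \<mu> $ Pos4 \<and>
        \<comment> \<open>piece +5\<close>
        (\<pi>ik $ Pos5, lk $ Pos5, \<mu> $ Pos5)
          \<in> W_check (H * fu) pju (max pil (pju / ru)) (min piu (pju / rl)) \<and>
        \<pi>jk $ Pos5 = pju * \<mu> $ Pos5 \<and> fk $ Pos5 = fu * \<mu> $ Pos5 \<and>
        \<comment> \<open>piece -1\<close>
        pil * \<mu> $ Neg1 \<le> \<pi>ik $ Neg1 \<and> \<pi>ik $ Neg1 \<le> piu * \<mu> $ Neg1 \<and>
        pjl * \<mu> $ Neg1 \<le> \<pi>jk $ Neg1 \<and> \<pi>jk $ Neg1 \<le> pju * \<mu> $ Neg1 \<and>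
        rl * \<pi>jk $ Neg1 \<le> \<pi>ik $ Neg1 \<and> \<pi>ik $ Neg1 \<le> ru * \<pi>jk $ Neg1 \<and>
        fk $ Neg1 = 0 \<and> lk $ Neg1 = 0 \<and>
        \<comment> \<open>piece -2\<close>
        (\<pi>ik $ Neg2, - lk $ Neg2, \<mu> $ Neg2)
          \<in> V_check (- H * fl) pjl (max pil (pjl * rl)) (min piu (pjl * ru)) \<and>
        \<pi>jk $ Neg2 = pjl * \<mu> $ Neg2 \<and> fk $ Neg2 = fl * \<mu> $ Neg2 \<and>
        \<comment> \<open>piece -3\<close>
        (\<pi>ik $ Neg3, - lk $ Neg3, \<mu> $ Neg3)
          \<in> V_check (- H * fl) pju (max pil (pju * rl)) (min piu (pju * ru)) \<and>
        \<pi>jk $ Neg3 = pju * \<mu> $ Neg3 \<and> fk $ Neg3 = fl * \<mu> $ Neg3 \<and>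
        \<comment> \<open>piece -4\<close>
        (\<pi>jk $ Neg4, - lk $ Neg4, \<mu> $ Neg4)
          \<in> W_check (- H * fl) pil (max pjl (pil / ru)) (min pju (pil / rl)) \<and>
        \<pi>ik $ Neg4 = pil * \<mu> $ Neg4 \<and> fk $ Neg4 = fl * \<mu> $ Neg4 \<and>
        \<comment> \<open>piece -5\<close>
        (\<pi>jk $ Neg5, - lk $ Neg5, \<mu> $ Neg5)
          \<in> W_check (- H * fl) piu (max pjl (piu / ru)) (min pju (piu / rl)) \<and>
        \<pi>ik $ Neg5 = piu * \<mu> $ Neg5 \<and> fk $ Neg5 = fl * \<mu> $ Neg5}"

definition proj :: "ext \<Rightarrow> real5" where
  "proj = (\<lambda>((\<pi>i, \<pi>j, f, l, x, xp, xm), _). (\<pi>i, \<pi>j, f, l, x))"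

end

theory Submission
  imports Defs
begin

text \<open>Second-order cone representability is preserved by intersections, affine preimages and linear
  images, and the system defining \<open>Y_set\<close> consists of affine constraints and rotated cone
  constraints; so \<open>Y_set\<close> and its projection are representable, hence convex. For the inclusion it
  is then enough to reach each point of the compression set by convex combinations. The loss is
  linear in the flow, which reduces to flow \<open>0\<close> (piece \<open>\<plusminus>1\<close>) or extreme flow; and for extreme
  flow it depends only on the pressure ratio, so sliding along the ray of constant ratio reduces to
  the boundary of the pressure box, whose four edges are covered by the pieces \<open>\<plusminus>2, \<dots>, \<plusminus>5\<close>.
  There \<open>1/9 \<le> \<kappa> \<le> 1/8\<close> makes the cone constraints a relaxation of the exact power, and the
  chord constraints hold by concavity or convexity of the power.\<close>

section \<open>Closure properties of second-order cone representable sets\<close>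

lemma affine_form_const [intro]: "affine_form m (\<lambda>x w. c)"
  unfolding affine_form_def by (rule exI[of _ c], rule exI[of _ 0], rule exI[of _ "\<lambda>_. 0"]) simp

lemma affine_form_add [intro]:
  assumes "affine_form m \<phi>" "affine_form m \<psi>"
  shows "affine_form m (\<lambda>x w. \<phi> x w + \<psi> x w)"
proof -
  obtain c a b c' a' b' where
    "\<And>x w. \<phi> x w = c + a \<bullet> x + (\<Sum>j<m. b j * w j)"
    "\<And>x w. \<psi> x w = c' + a' \<bullet> x + (\<Sum>j<m. b' j * w j)"
    using assms unfolding affine_form_def by metis
  then have "\<And>x w. \<phi> x w + \<psi> x w = (c + c') + (a + a') \<bullet> x + (\<Sum>j<m. (b j + b' j) * w j)"
    by (simp add: algebra_simps sum.distrib)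
  then show ?thesis unfolding affine_form_def by (intro exI allI)
qed

lemma affine_form_scale [intro]:
  assumes "affine_form m \<phi>"
  shows "affine_form m (\<lambda>x w. r * \<phi> x w)"
proof -
  obtain c a b where
    "\<And>x w. \<phi> x w = c + a \<bullet> x + (\<Sum>j<m. b j * w j)"
    using assms unfolding affine_form_def by metis
  then have "\<And>x w. r * \<phi> x w = (r * c) + (r *\<^sub>R a) \<bullet> x + (\<Sum>j<m. (r * b j) * w j)"
    by (simp add: algebra_simps sum_distrib_left)
  then show ?thesis unfolding affine_form_def by (intro exI allI)
qed

lemma affine_form_sum [intro]:
  assumes "\<And>i. i \<in> I \<Longrightarrow> affine_form m (\<phi> i)"
  shows "affine_form m (\<lambda>x w. \<Sum>i\<in>I. \<phi> i x w)"
  using assms by (induction I rule: infinite_finite_induct) auto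

lemma affine_form_var [intro]: "j < m \<Longrightarrow> affine_form m (\<lambda>x w. w j)"
  unfolding affine_form_def
  by (rule exI[of _ 0], rule exI[of _ 0], rule exI[of _ "\<lambda>i. if i = j then 1 else 0"])
     (simp add: if_distrib[of "\<lambda>t. t * _"] cong: if_cong)

lemma affine_form_inner [intro]: "affine_form m (\<lambda>x w. a \<bullet> x)"
  unfolding affine_form_def by (rule exI[of _ 0], rule exI[of _ a], rule exI[of _ "\<lambda>_. 0"]) simp

text \<open>All later changes of variables go through this substitution: shifting witness indices,
  turning coordinates of the point into witnesses, pulling back along a map. Coordinates of
  \<open>g\<close> suffice because \<open>a \<bullet> g x w\<close> expands over
  \<open>Basis\<close>.\<close>

lemma affine_form_compose:
  assumes "affine_form m \<phi>"
    and g: "\<And>e. e \<in> Basis \<Longrightarrow> affine_form m' (\<lambda>x w. g x w \<bullet> e)"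
    and h: "\<And>j. j < m \<Longrightarrow> affine_form m' (\<lambda>x w. h x w j)"
  shows "affine_form m' (\<lambda>x w. \<phi> (g x w) (h x w))"
proof -
  obtain c a b where \<phi>: "\<And>x w. \<phi> x w = c + a \<bullet> x + (\<Sum>j<m. b j * w j)"
    using assms unfolding affine_form_def by metis
  have "affine_form m' (\<lambda>x w. c + (\<Sum>e\<in>Basis. (a \<bullet> e) * (g x w \<bullet> e)) + (\<Sum>j<m. b j * h x w j))"
    using g h by (intro affine_form_add affine_form_const affine_form_sum affine_form_scale) auto
  moreover have "\<phi> (g x w) (h x w)
      = c + (\<Sum>e\<in>Basis. (a \<bullet> e) * (g x w \<bullet> e)) + (\<Sum>j<m. b j * h x w j)" for x w
    by (simp only: \<phi> euclidean_inner[of a "g x w"])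
  ultimately show ?thesis by (simp only:)
qed

lemma affine_form_combination:
  assumes "affine_form m \<phi>" "u + v = 1"
  shows "\<phi> (u *\<^sub>R x + v *\<^sub>R y) (\<lambda>j. u * w j + v * w' j) = u * \<phi> x w + v * \<phi> y w'"
proof -
  obtain c a b where \<phi>: "\<And>x w. \<phi> x w = c + a \<bullet> x + (\<Sum>j<m. b j * w j)"
    using assms unfolding affine_form_def by metis
  have v: "v = 1 - u" using assms(2) by simp
  show ?thesis unfolding \<phi> v
    by (simp add: algebra_simps sum.distrib sum_subtractf sum_distrib_left)
qed

lemma lorentz_cone_combination:
  assumes "z \<in> lorentz_cone d" "z' \<in> lorentz_cone d" "0 \<le> u" "0 \<le> v"
    and "\<And>i. i \<le> d \<Longrightarrow> y i = u * z i + v * z' i"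
  shows "y \<in> lorentz_cone d"
proof -
  have "L2_set y {1..d} = L2_set (\<lambda>i. u * z i + v * z' i) {1..d}"
    using assms(5) by (intro L2_set_cong) auto
  also have "\<dots> \<le> L2_set (\<lambda>i. u * z i) {1..d} + L2_set (\<lambda>i. v * z' i) {1..d}"
    by (rule L2_set_triangle_ineq)
  also have "\<dots> = u * L2_set z {1..d} + v * L2_set z' {1..d}"
    using assms by (simp add: L2_set_right_distrib)
  also have "\<dots> \<le> u * z 0 + v * z' 0"
    using assms by (intro add_mono mult_left_mono) (auto simp: lorentz_cone_def)
  finally show ?thesis using assms(5)[of 0] by (simp add: lorentz_cone_def)
qed

lemma lorentz_cone_cong:
  assumes "\<And>i. i \<le> d \<Longrightarrow> y i = z i"
  shows "y \<in> lorentz_cone d \<longleftrightarrow> z \<in> lorentz_cone d"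
proof -
  have "L2_set y {1..d} = L2_set z {1..d}" using assms by (intro L2_set_cong) auto
  then show ?thesis using assms[of 0] by (simp add: lorentz_cone_def)
qed

section \<open>Intersections and projections of representable sets\<close>

lemma SOCrI:
  fixes N :: nat
  assumes aff: "\<And>k i. k < N \<Longrightarrow> i \<le> d k \<Longrightarrow> affine_form m (\<lambda>x w. T x w k i)"
    and Y: "\<And>x. x \<in> Y \<longleftrightarrow> (\<exists>w. \<forall>k<N. T x w k \<in> lorentz_cone (d k))"
  shows "SOCr Y"
proof -
  have "convex Y"
  proof (rule convexI)
    fix x y u v assume xy: "x \<in> Y" "y \<in> Y" and uv: "0 \<le> (u::real)" "0 \<le> v" "u + v = 1"
    obtain w where w: "\<forall>k<N. T x w k \<in> lorentz_cone (d k)"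
      using xy(1) unfolding Y by (elim exE)
    obtain w' where w': "\<forall>k<N. T y w' k \<in> lorentz_cone (d k)"
      using xy(2) unfolding Y by (elim exE)
    \<comment> \<open>The blocks are affine in point and witness jointly, so mixing the two
      witnesses with the same weights certifies the mixed point.\<close>
    have "T (u *\<^sub>R x + v *\<^sub>R y) (\<lambda>j. u * w j + v * w' j) k \<in> lorentz_cone (d k)" if k: "k < N" for k
    proof (rule lorentz_cone_combination[OF _ _ uv(1,2)])
      show "T x w k \<in> lorentz_cone (d k)" "T y w' k \<in> lorentz_cone (d k)"
        using w w' k by auto
      show "T (u *\<^sub>R x + v *\<^sub>R y) (\<lambda>j. u * w j + v * w' j) k i = u * T x w k i + v * T y w' k i"
        if "i \<le> d k" for i
        by (rule affine_form_combination[OF aff[OF k that] uv(3)])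
    qed
    then show "u *\<^sub>R x + v *\<^sub>R y \<in> Y"
      unfolding Y by (intro exI[of _ "\<lambda>j. u * w j + v * w' j"] allI impI)
  qed
  moreover have "Y = {x. \<exists>w. \<forall>k<N. T x w k \<in> lorentz_cone (d k)}"
    by (rule set_eqI) (simp only: Y mem_Collect_eq)
  moreover have "\<forall>k<N. \<forall>i\<le>d k. affine_form m (\<lambda>x w. T x w k i)"
    by (intro allI impI aff)
  ultimately show ?thesis unfolding SOCr_def
    by (intro conjI exI[of _ m] exI[of _ N] exI[of _ d] exI[of _ T])
qed

lemma SOCrE:
  assumes "SOCr Y"
  obtains m :: nat and N :: nat and d T where
    "\<forall>k<N. \<forall>i\<le>d k. affine_form m (\<lambda>x w. T x w k i)"
    "\<forall>x. x \<in> Y \<longleftrightarrow> (\<exists>w. \<forall>k<N. T x w k \<in> lorentz_cone (d k))"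
proof -
  from assms obtain m and N :: nat and d T where
    "\<forall>k<N. \<forall>i\<le>d k. affine_form m (\<lambda>x w. T x w k i)"
    "Y = {x. \<exists>w. \<forall>k<N. T x w k \<in> lorentz_cone (d k)}"
    unfolding SOCr_def by (elim conjE exE) (rule that)
  then show thesis by (intro that[of N d m T]) auto
qed

text \<open>The two systems are stacked: blocks from \<open>N\<close> on belong to \<open>B\<close>,
  and they read their witnesses from index \<open>m\<close> on, so the two witness vectors do not
  interfere.\<close>

lemma SOCr_Int:
  assumes "SOCr A" "SOCr B"
  shows "SOCr (A \<inter> B)"
proof -
  obtain m and N :: nat and d T where raw1: "\<forall>k<N. \<forall>i\<le>d k. affine_form m (\<lambda>x w. T x w k i)"
    "\<forall>x. x \<in> A \<longleftrightarrow> (\<exists>w. \<forall>k<N. T x w k \<in> lorentz_cone (d k))"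
    by (rule SOCrE[OF assms(1)]) (rule that)
  note 1 = raw1[rule_format]
  obtain m' and N' :: nat and d' T' where raw2: "\<forall>k<N'. \<forall>i\<le>d' k. affine_form m' (\<lambda>x w. T' x w k i)"
    "\<forall>x. x \<in> B \<longleftrightarrow> (\<exists>w. \<forall>k<N'. T' x w k \<in> lorentz_cone (d' k))"
    by (rule SOCrE[OF assms(2)]) (rule that)
  note 2 = raw2[rule_format]
  define D where "D k = (if k < N then d k else d' (k - N))" for k
  define S where "S x w k = (if k < N then T x w k else T' x (\<lambda>j. w (m + j)) (k - N))" for x w k
  show ?thesis
  proof (rule SOCrI[of "N + N'" D "m + m'" S])
    fix k i assume k: "k < N + N'" "i \<le> D k"
    show "affine_form (m + m') (\<lambda>x w. S x w k i)"
    proof (cases "k < N")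
      case True
      have "affine_form (m + m') (\<lambda>x w. T x w k i)"
        using k True by (intro affine_form_compose[OF 1(1)[of k i]])
          (auto simp: D_def inner_commute[of _ "_::'a"])
      with True show ?thesis by (simp add: S_def)
    next
      case False
      have "affine_form (m + m') (\<lambda>x w. T' x (\<lambda>j. w (m + j)) (k - N) i)"
        using k False by (intro affine_form_compose[OF 2(1)[of "k - N" i]])
          (auto simp: D_def inner_commute[of _ "_::'a"])
      with False show ?thesis by (simp add: S_def)
    qed
  next
    fix x
    show "x \<in> A \<inter> B \<longleftrightarrow> (\<exists>w. \<forall>k<N + N'. S x w k \<in> lorentz_cone (D k))"
    proof
      assume "x \<in> A \<inter> B"
      then obtain w w' where w: "\<forall>k<N. T x w k \<in> lorentz_cone (d k)"
        "\<forall>k<N'. T' x w' k \<in> lorentz_cone (d' k)"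
        unfolding Int_iff 1(2) 2(2) by (elim conjE exE)
      define v where "v j = (if j < m then w j else w' (j - m))" for j
      have v': "(\<lambda>j. v (m + j)) = w'" by (simp add: v_def)
      \<comment> \<open>\<open>v\<close> agrees with \<open>w\<close> only below \<open>m\<close>,
        and a block is known to be affine only in its coordinates up to \<open>d k\<close>; the cone
        reads no others.\<close>
      have "T x v k \<in> lorentz_cone (d k)" if "k < N" for k
      proof -
        have "T x v k i = T x w k i" if i: "i \<le> d k" for i
        proof -
          obtain c a b where "\<And>x w. T x w k i = c + a \<bullet> x + (\<Sum>j<m. b j * w j)"
            using 1(1)[OF \<open>k < N\<close> i] unfolding affine_form_def by metis
          then show ?thesis by (simp add: v_def)
        qed
        with w(1) that show ?thesis using lorentz_cone_cong[of "d k" "T x v k" "T x w k"] by auto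
      qed
      then show "\<exists>w. \<forall>k<N + N'. S x w k \<in> lorentz_cone (D k)"
        using w(2) by (intro exI[of _ v]) (auto simp: S_def D_def v')
    next
      assume "\<exists>w. \<forall>k<N + N'. S x w k \<in> lorentz_cone (D k)"
      then obtain w where w: "\<And>k. k<N + N' \<Longrightarrow> S x w k \<in> lorentz_cone (D k)" by blast
      have "T x w k \<in> lorentz_cone (d k)" if "k < N" for k
        using w[of k] that by (simp add: S_def D_def)
      moreover have "T' x (\<lambda>j. w (m + j)) k \<in> lorentz_cone (d' k)" if "k < N'" for k
        using w[of "N + k"] that by (simp add: S_def D_def)
      ultimately show "x \<in> A \<inter> B" unfolding Int_iff 1(2) 2(2) by auto
    qed
  qed
qed

lemma SOCr_Collect_conj: "SOCr {x. P x} \<Longrightarrow> SOCr {x. Q x} \<Longrightarrow> SOCr {x. P x \<and> Q x}"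
  by (metis SOCr_Int Collect_conj_eq)

lemma SOCr_UNIV: "SOCr UNIV"
  by (rule SOCrI[of 0]) auto

lemma SOCr_Collect_all:
  fixes P :: "'i::finite \<Rightarrow> 'a::euclidean_space \<Rightarrow> bool"
  assumes "\<And>k. SOCr {x. P k x}"
  shows "SOCr {x. \<forall>k. P k x}"
proof -
  have "SOCr {x. \<forall>k\<in>F. P k x}" if "finite F" for F
    using that
  proof induction
    case (insert k F)
    then show ?case using SOCr_Collect_conj[OF assms[of k]] by simp
  qed (simp add: SOCr_UNIV)
  from this[of UNIV] show ?thesis by simp
qed

text \<open>The discarded component becomes \<open>DIM('b)\<close> further witnesses:
  \<open>h\<close> numbers \<open>Basis\<close>, and \<open>g\<close> rebuilds the component from
  the witness entries starting at \<open>m\<close>.\<close>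

lemma SOCr_fst_image:
  fixes S :: "('a::euclidean_space \<times> 'b::euclidean_space) set"
  assumes "SOCr S"
  shows "SOCr (fst ` S)"
proof -
  obtain m and N :: nat and d T where rawT: "\<forall>k<N. \<forall>i\<le>d k. affine_form m (\<lambda>x w. T x w k i)"
    "\<forall>x. x \<in> S \<longleftrightarrow> (\<exists>w. \<forall>k<N. T x w k \<in> lorentz_cone (d k))"
    by (rule SOCrE[OF assms]) (rule that)
  note T = rawT[rule_format]
  obtain h where "bij_betw h (Basis :: 'b set) {0..<DIM('b)}"
    using ex_bij_betw_finite_nat[OF finite_Basis] by metis
  then have h: "inj_on h Basis" "h ` (Basis :: 'b set) = {0..<DIM('b)}"
    by (auto simp: bij_betw_def)
  have hlt: "h e < DIM('b)" if "e \<in> Basis" for e using h that by auto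
  define g :: "(nat \<Rightarrow> real) \<Rightarrow> 'b" where "g w = (\<Sum>e\<in>Basis. w (m + h e) *\<^sub>R e)" for w
  have g: "g w \<bullet> e = w (m + h e)" if "e \<in> Basis" for w e
    using that by (simp add: g_def)
  show ?thesis
  proof (rule SOCrI[of N d "m + DIM('b)" "\<lambda>x w. T (x, g w) w"])
    fix k i assume "k < N" "i \<le> d k"
    then show "affine_form (m + DIM('b)) (\<lambda>x w. T (x, g w) w k i)"
    proof (intro affine_form_compose[OF T(1)[of k i]])
      fix e :: "'a \<times> 'b" assume "e \<in> Basis"
      then show "affine_form (m + DIM('b)) (\<lambda>x w. (x, g w) \<bullet> e)"
        using affine_form_var[of "m + h (snd e)" "m + DIM('b)"] hlt[of "snd e"]
        by (auto simp: Basis_prod_def g inner_commute[of _ "_::'a"])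
    qed auto
  next
    fix x
    show "x \<in> fst ` S \<longleftrightarrow> (\<exists>w. \<forall>k<N. T (x, g w) w k \<in> lorentz_cone (d k))"
    proof
      assume "x \<in> fst ` S"
      then obtain y where "(x, y) \<in> S" by auto
      then obtain w where w: "\<And>k. k<N \<Longrightarrow> T (x, y) w k \<in> lorentz_cone (d k)" unfolding T(2) by auto
      define v where "v j = (if j < m then w j else y \<bullet> inv_into Basis h (j - m))" for j
      have gv: "g v = y"
        by (rule euclidean_eqI) (use h(1) in \<open>simp add: g v_def\<close>)
      have "T (x, g v) v k \<in> lorentz_cone (d k)" if "k < N" for k
      proof -
        have "T (x, y) v k i = T (x, y) w k i" if i: "i \<le> d k" for i
        proof -
          obtain c a b where "\<And>x w. T x w k i = c + a \<bullet> x + (\<Sum>j<m. b j * w j)"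
            using T(1)[OF \<open>k < N\<close> i] unfolding affine_form_def by metis
          then show ?thesis by (simp add: v_def)
        qed
        with w that show ?thesis
          using lorentz_cone_cong[of "d k" "T (x, y) v k" "T (x, y) w k"] gv by auto
      qed
      then show "\<exists>w. \<forall>k<N. T (x, g w) w k \<in> lorentz_cone (d k)" by blast
    next
      assume "\<exists>w. \<forall>k<N. T (x, g w) w k \<in> lorentz_cone (d k)"
      then obtain w where "(x, g w) \<in> S" using T(2)[of "(x, g _)"] by metis
      then show "x \<in> fst ` S" by force
    qed
  qed
qed

section \<open>Affine maps and the constraints built from them\<close>

definition affine_map :: "('a::euclidean_space \<Rightarrow> 'b::euclidean_space) \<Rightarrow> bool" where
  "affine_map f \<longleftrightarrow> (\<exists>c L. linear L \<and> (\<forall>x. f x = c + L x))"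

text \<open>These rules follow the syntax of an expression, so that affinity of each side of a
  constraint is found by repeated introduction.\<close>

named_theorems affine_map_intros

lemma affine_map_linear: "linear f \<Longrightarrow> affine_map f"
  unfolding affine_map_def by (rule exI[of _ 0], rule exI[of _ f]) simp

lemma affine_map_const [affine_map_intros]: "affine_map (\<lambda>x. c)"
  unfolding affine_map_def by (rule exI[of _ c], rule exI[of _ "\<lambda>_. 0"]) (simp add: linear_zero)

lemma affine_map_id [affine_map_intros]: "affine_map (\<lambda>x. x)"
  by (simp add: affine_map_linear linear_ident)

lemma affine_map_linear_compose:
  assumes "linear g" "affine_map f"
  shows "affine_map (\<lambda>x. g (f x))"
proof -
  obtain c L where L: "linear L" "\<And>x. f x = c + L x" using assms by (auto simp: affine_map_def)
  have "linear (\<lambda>x. g (L x))" using linear_compose[OF L(1) assms(1)] by (simp add: o_def)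
  moreover have "g (f x) = g c + g (L x)" for x using assms(1) by (simp add: L linear_add)
  ultimately show ?thesis unfolding affine_map_def by blast
qed

lemma affine_map_add [affine_map_intros]:
  assumes "affine_map f" "affine_map g"
  shows "affine_map (\<lambda>x. f x + g x)"
proof -
  obtain c L c' L' where "linear L" "\<And>x. f x = c + L x" "linear L'" "\<And>x. g x = c' + L' x"
    using assms by (auto simp: affine_map_def)
  then have "linear (\<lambda>x. L x + L' x)" "\<And>x. f x + g x = (c + c') + (L x + L' x)"
    by (auto intro: linear_compose_add)
  then show ?thesis unfolding affine_map_def by (intro exI conjI allI)
qed

lemma affine_map_fst [affine_map_intros]: "affine_map f \<Longrightarrow> affine_map (\<lambda>x. fst (f x))"
  by (rule affine_map_linear_compose[OF linear_fst])

lemma affine_map_snd [affine_map_intros]: "affine_map f \<Longrightarrow> affine_map (\<lambda>x. snd (f x))"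
  by (rule affine_map_linear_compose[OF linear_snd])

lemma affine_map_nth [affine_map_intros]:
  fixes f :: "'a::euclidean_space \<Rightarrow> real ^ 'n"
  shows "affine_map f \<Longrightarrow> affine_map (\<lambda>x. f x $ k)"
  by (rule affine_map_linear_compose) (simp add: bounded_linear.linear bounded_linear_vec_nth)

lemma affine_map_uminus [affine_map_intros]: "affine_map f \<Longrightarrow> affine_map (\<lambda>x. - f x)"
  by (rule affine_map_linear_compose[OF linear_uminus])

lemma affine_map_diff [affine_map_intros]:
  "affine_map f \<Longrightarrow> affine_map g \<Longrightarrow> affine_map (\<lambda>x. f x - g x)"
  using affine_map_add[of f "\<lambda>x. - g x"] affine_map_uminus[of g] by simp

lemma affine_map_mult_left [affine_map_intros]:
  "affine_map f \<Longrightarrow> affine_map (\<lambda>x. (r::real) * f x)"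
  by (rule affine_map_linear_compose) (simp add: bounded_linear.linear bounded_linear_mult_right)

lemma affine_map_sum [affine_map_intros]:
  assumes "\<And>i. i \<in> I \<Longrightarrow> affine_map (f i)"
  shows "affine_map (\<lambda>x. \<Sum>i\<in>I. f i x)"
  using assms by (induction I rule: infinite_finite_induct) (auto intro: affine_map_intros)

lemma affine_map_Pair [affine_map_intros]:
  assumes "affine_map f" "affine_map g"
  shows "affine_map (\<lambda>x. (f x, g x))"
proof -
  have "linear (\<lambda>y. (y, 0))" "linear (\<lambda>y. (0, y))" by (auto intro!: linearI)
  from affine_map_add[OF affine_map_linear_compose[OF this(1) assms(1)]
      affine_map_linear_compose[OF this(2) assms(2)]]
  show ?thesis by simp
qed

text \<open>The adjoint moves \<open>L\<close> across the inner product, which gives the coefficient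
  vector \<open>adjoint L e\<close>; the witness coefficients are 0.\<close>

lemma affine_map_affine_form:
  assumes "affine_map f"
  shows "affine_form m (\<lambda>x w. f x \<bullet> e)"
proof -
  obtain c L where L: "linear L" "\<And>x. f x = c + L x" using assms by (auto simp: affine_map_def)
  have "f x \<bullet> e = c \<bullet> e + adjoint L e \<bullet> x + (\<Sum>j<m. 0 * w j)" for x w
    unfolding L(2) inner_add_left adjoint_works[OF L(1), of x e, symmetric]
      inner_commute[of "adjoint L e" x] by simp
  then show ?thesis unfolding affine_form_def
    by (intro exI[of _ "c \<bullet> e"] exI[of _ "adjoint L e"] exI[of _ "\<lambda>_. 0"] allI)
qed

lemma SOCr_vimage:
  assumes "SOCr A" "affine_map f"
  shows "SOCr {x. f x \<in> A}"
proof -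
  obtain m and N :: nat and d T where rawT: "\<forall>k<N. \<forall>i\<le>d k. affine_form m (\<lambda>x w. T x w k i)"
    "\<forall>x. x \<in> A \<longleftrightarrow> (\<exists>w. \<forall>k<N. T x w k \<in> lorentz_cone (d k))"
    by (rule SOCrE[OF assms(1)]) (rule that)
  note T = rawT[rule_format]
  show ?thesis
  proof (rule SOCrI[of N d m "\<lambda>x. T (f x)"])
    fix k i assume "k < N" "i \<le> d k"
    then show "affine_form m (\<lambda>x w. T (f x) w k i)"
      using affine_map_affine_form[OF assms(2)] by (intro affine_form_compose[OF T(1)]) auto
  qed (simp add: T(2))
qed

text \<open>The cone for \<open>d = 0\<close> is the half-line, so a block with the single
  coordinate \<open>g x - f x\<close> and no witnesses suffices.\<close>

lemma SOCr_Collect_le: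
  fixes f g :: "'a::euclidean_space \<Rightarrow> real"
  assumes "affine_map f" "affine_map g"
  shows "SOCr {x. f x \<le> g x}"
proof (rule SOCrI[of 1 "\<lambda>_. 0" 0 "\<lambda>x w k i. g x - f x"])
  show "affine_form 0 (\<lambda>x w. g x - f x)"
    using affine_map_affine_form[OF affine_map_diff[OF assms(2,1)], of 0 1] by simp
qed (auto simp: lorentz_cone_def)

lemma SOCr_Collect_eq:
  fixes f g :: "'a::euclidean_space \<Rightarrow> real"
  assumes "affine_map f" "affine_map g"
  shows "SOCr {x. f x = g x}"
  using SOCr_Collect_conj[OF SOCr_Collect_le[OF assms] SOCr_Collect_le[OF assms(2,1)]]
  by (simp add: order.eq_iff)

lemma SOCr_Collect_eq_euclidean:
  fixes f g :: "'a::euclidean_space \<Rightarrow> 'b::euclidean_space"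
  assumes "affine_map f" "affine_map g"
  shows "SOCr {x. f x = g x}"
proof -
  have "SOCr {x. \<forall>e\<in>F. f x \<bullet> e = g x \<bullet> e}" if "finite F" for F
    using that
  proof induction
    case (insert e F)
    have "linear (\<lambda>y. y \<bullet> e)" by (intro linearI) (auto simp: inner_add_left)
    then have "SOCr {x. f x \<bullet> e = g x \<bullet> e}"
      by (intro SOCr_Collect_eq affine_map_linear_compose[of "\<lambda>y. y \<bullet> e"] assms)
    with insert show ?case using SOCr_Collect_conj by simp
  qed (simp add: SOCr_UNIV)
  from this[OF finite_Basis] show ?thesis by (simp add: euclidean_eq_iff[symmetric])
qed

text \<open>The image is the projection of the graph over \<open>A\<close>, and the graph is cut out
  by an affine preimage and a vector equation.\<close>

lemma SOCr_linear_image: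
  assumes "SOCr A" "linear f"
  shows "SOCr (f ` A)"
proof -
  have "SOCr {p. snd p \<in> A \<and> fst p = f (snd p)}"
    by (intro SOCr_Collect_conj SOCr_vimage[OF assms(1)] SOCr_Collect_eq_euclidean
        affine_map_linear_compose[OF assms(2)] affine_map_intros)
  then have "SOCr (fst ` {p. snd p \<in> A \<and> fst p = f (snd p)})"
    by (rule SOCr_fst_image)
  moreover have "fst ` {p. snd p \<in> A \<and> fst p = f (snd p)} = f ` A"
    by (auto simp: image_def)
  ultimately show ?thesis by simp
qed

text \<open>For nonnegative \<open>g\<close> and \<open>h\<close>, \<open>f\<^sup>2 \<le> g h\<close> says that \<open>(g + h, 2 f, g - h)\<close> lies in the Lorentz cone.\<close>

lemma SOCr_rotated_cone:
  fixes f g h :: "'a::euclidean_space \<Rightarrow> real"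
  assumes "affine_map f" "affine_map g" "affine_map h"
  shows "SOCr {x. 0 \<le> g x \<and> 0 \<le> h x \<and> (f x)\<^sup>2 \<le> g x * h x}"
proof (rule SOCrI[of 1 "\<lambda>_. 2" 0
      "\<lambda>x w k i. if i = 0 then g x + h x else if i = 1 then 2 * f x else g x - h x"])
  fix i :: nat
  have "affine_map (\<lambda>x. if i = 0 then g x + h x else if i = 1 then 2 * f x else g x - h x)"
    using assms by (cases "i = 0"; cases "i = 1"; simp add: affine_map_intros)
  from affine_map_affine_form[OF this, of 0 1]
  show "affine_form 0 (\<lambda>x w. if i = 0 then g x + h x else if i = 1 then 2 * f x else g x - h x)"
    by simp
next
  fix x
  have 1: "{Suc 0..2} = {1, 2}" by auto
  have "(0 \<le> g x \<and> 0 \<le> h x \<and> (f x)\<^sup>2 \<le> g x * h x)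
      \<longleftrightarrow> sqrt ((2 * f x)\<^sup>2 + (g x - h x)\<^sup>2) \<le> g x + h x" (is "?L \<longleftrightarrow> ?R")
  proof
    assume ?L then show ?R
      by (intro real_le_lsqrt) (auto simp: power2_eq_square algebra_simps)
  next
    assume ?R
    then have s: "0 \<le> g x + h x" by (meson order_trans real_sqrt_ge_zero sum_power2_ge_zero)
    have "(2 * f x)\<^sup>2 + (g x - h x)\<^sup>2 \<le> (g x + h x)\<^sup>2"
      using \<open>?R\<close> s by (metis real_sqrt_le_iff real_sqrt_unique)
    then have fgh: "(f x)\<^sup>2 \<le> g x * h x" by (simp add: power2_eq_square algebra_simps)
    \<comment> \<open>A nonnegative product leaves two sign patterns; the nonnegative sum
      \<open>s\<close> excludes a negative factor.\<close>
    then have "0 \<le> g x * h x" by (meson order_trans zero_le_power2)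
    with s fgh show ?L by (auto simp: zero_le_mult_iff)
  qed
  then show "x \<in> {x. 0 \<le> g x \<and> 0 \<le> h x \<and> (f x)\<^sup>2 \<le> g x * h x} \<longleftrightarrow>
    (\<exists>w. \<forall>k<1::nat. (\<lambda>i. if i = 0 then g x + h x else if i = 1 then 2 * f x else g x - h x)
         \<in> lorentz_cone 2)"
    by (simp add: lorentz_cone_def L2_set_def 1)
qed

text \<open>The inequalities are kept as one membership because \<open>f\<^sup>2 \<le> g * h\<close>
  without the signs is not convex in general and must not be split off by
  \<open>SOCr_Collect_conj\<close>.\<close>

definition rotated_cone :: "(real \<times> real \<times> real) set" where
  "rotated_cone = {(f, g, h). 0 \<le> g \<and> 0 \<le> h \<and> f\<^sup>2 \<le> g * h}"

lemma SOCr_Collect_rotated_cone: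
  fixes f g h :: "'a::euclidean_space \<Rightarrow> real"
  assumes "affine_map f" "affine_map g" "affine_map h"
  shows "SOCr {x. (f x, g x, h x) \<in> rotated_cone}"
  using SOCr_rotated_cone[OF assms] by (simp add: rotated_cone_def)

section \<open>The compression set\<close>

lemma mem_fst_image_iff: "x \<in> fst ` S \<longleftrightarrow> (\<exists>y. (x, y) \<in> S)"
  by force

text \<open>The existential variables become coordinates that are projected away. The factor
  \<open>sqrt b\<close> absorbs \<open>b\<close> into the square, and \<open>rotated_cone\<close>
  supplies the signs of \<open>v1\<close> and \<open>v2\<close>.\<close>

lemma SOCr_V_check:
  assumes "0 \<le> b"
  shows "SOCr (V_check a b xl xu)"
proof -
  let ?S = "{p :: (real \<times> real \<times> real) \<times> real \<times> real \<times> real.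
     0 \<le> fst (fst p) \<and> 0 \<le> fst (snd (fst p)) \<and> 0 \<le> fst (snd p) \<and>
     (fst (snd p), snd (snd (fst p)), fst (snd (snd p))) \<in> rotated_cone \<and>
     (fst (snd (snd p)), snd (snd (fst p)), snd (snd (snd p))) \<in> rotated_cone \<and>
     (sqrt b * snd (snd (snd p)), snd (snd (fst p)), fst (fst p)) \<in> rotated_cone \<and>
     fst (snd (fst p)) = a * (fst (snd p) - snd (snd (fst p))) \<and>
     xl * snd (snd (fst p)) \<le> fst (fst p) \<and> fst (fst p) \<le> xu * snd (snd (fst p)) \<and>
     a * \<sigma>V b xl xu * (fst (fst p) - xl * snd (snd (fst p)))
       + a * ((xl / b) powr \<kappa> - 1) * snd (snd (fst p)) \<le> fst (snd (fst p))}"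
  have "SOCr ?S"
    by (intro SOCr_Collect_conj SOCr_Collect_rotated_cone SOCr_Collect_le SOCr_Collect_eq
        affine_map_intros)
  then have "SOCr (fst ` ?S)" by (rule SOCr_fst_image)
  moreover have "V_check a b xl xu = fst ` ?S"
  proof (rule set_eqI)
    fix p :: "real \<times> real \<times> real"
    obtain x y \<mu> where p: "p = (x, y, \<mu>)" by (cases p)
    have "p \<in> V_check a b xl xu \<longleftrightarrow> (\<exists>u v1 v2. (p, u, v1, v2) \<in> ?S)"
      unfolding p V_check_def mem_Collect_eq case_prod_conv ex_simps(2)[symmetric]
      using assms by (intro ex_cong1) (auto simp: rotated_cone_def power_mult_distrib)
    then show "p \<in> V_check a b xl xu \<longleftrightarrow> p \<in> fst ` ?S"
      unfolding mem_fst_image_iff by (simp only: split_paired_Ex)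
  qed
  ultimately show ?thesis by simp
qed

lemma SOCr_W_check:
  assumes "0 \<le> b"
  shows "SOCr (W_check a b xl xu)"
proof -
  let ?S = "{p :: (real \<times> real \<times> real) \<times> real \<times> real \<times> real \<times> real.
     0 \<le> fst (snd (fst p)) \<and> 0 \<le> snd (snd (fst p)) \<and>
     (snd (snd (fst p)), fst (snd p), fst (snd (snd p))) \<in> rotated_cone \<and>
     (fst (snd (snd p)), snd (snd (fst p)), fst (snd (snd (snd p)))) \<in> rotated_cone \<and>
     (fst (snd (snd (snd p))), snd (snd (fst p)), snd (snd (snd (snd p)))) \<in> rotated_cone \<and>
     (sqrt b * snd (snd (snd (snd p))), fst (snd p), fst (fst p)) \<in> rotated_cone \<and>
     fst (snd (fst p)) = a * (fst (snd p) - snd (snd (fst p))) \<and>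
     xl * snd (snd (fst p)) \<le> fst (fst p) \<and> fst (fst p) \<le> xu * snd (snd (fst p)) \<and>
     fst (snd (fst p)) \<le> a * \<sigma>W b xl xu * (fst (fst p) - xl * snd (snd (fst p)))
       + a * ((b / xl) powr \<kappa> - 1) * snd (snd (fst p))}"
  have "SOCr ?S"
    by (intro SOCr_Collect_conj SOCr_Collect_rotated_cone SOCr_Collect_le SOCr_Collect_eq
        affine_map_intros)
  then have "SOCr (fst ` ?S)" by (rule SOCr_fst_image)
  moreover have "W_check a b xl xu = fst ` ?S"
  proof (rule set_eqI)
    fix p :: "real \<times> real \<times> real"
    obtain x y \<mu> where p: "p = (x, y, \<mu>)" by (cases p)
    have "p \<in> W_check a b xl xu \<longleftrightarrow> (\<exists>u v1 v2 v3. (p, u, v1, v2, v3) \<in> ?S)"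
      unfolding p W_check_def mem_Collect_eq case_prod_conv ex_simps(2)[symmetric]
      using assms by (intro ex_cong1) (auto simp: rotated_cone_def power_mult_distrib)
    then show "p \<in> W_check a b xl xu \<longleftrightarrow> p \<in> fst ` ?S"
      unfolding mem_fst_image_iff by (simp only: split_paired_Ex)
  qed
  ultimately show ?thesis by simp
qed

text \<open>Each conjunct is an affine equation or inequality, or an affine preimage of a check set.
  The pressure bounds serve as \<open>b\<close> there, hence their signs.\<close>

lemma SOCr_Y_set:
  assumes "0 \<le> pil" "0 \<le> piu" "0 \<le> pjl" "0 \<le> pju"
  shows "SOCr (Y_set pil piu pjl pju fl fu rl ru H)"
  unfolding Y_set_def case_prod_unfold atLeastAtMost_iff
  by (intro SOCr_Collect_conj SOCr_Collect_all SOCr_Collect_le SOCr_Collect_eq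
      SOCr_vimage[OF SOCr_V_check] SOCr_vimage[OF SOCr_W_check] assms affine_map_intros)

lemma linear_proj: "linear proj"
  by (rule linearI) (auto simp: proj_def)

section \<open>Power functions and membership in the check sets\<close>

lemma powr_chord_le:
  fixes c x y p :: real
  assumes "0 < x" "x \<le> c" "c \<le> y" "0 \<le> p" "p \<le> 1"
  shows "(y powr p - x powr p) / (y - x) * (c - x) + x powr p \<le> c powr p"
proof -
  have "concave_on {0<..} (\<lambda>x::real. x powr p)"
  proof (rule f''_le0_imp_concave)
    fix z :: real assume "z \<in> {0<..}"
    then have z: "0 < z" by simp
    show "((\<lambda>x. x powr p) has_real_derivative p * z powr (p - 1)) (at z)"
      using z by (auto intro!: derivative_eq_intros)
    show "((\<lambda>x. p * x powr (p - 1)) has_real_derivative p * ((p - 1) * z powr (p - 1 - 1))) (at z)"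
      using z by (auto intro!: derivative_eq_intros)
    show "p * ((p - 1) * z powr (p - 1 - 1)) \<le> 0"
      using assms by (simp add: mult_le_0_iff mult_nonneg_nonpos mult_nonpos_nonneg)
  qed simp
  then have "concave_on {x..y} (\<lambda>x. x powr p)"
    unfolding concave_on_def by (rule convex_on_subset) (use assms in auto)
  from concave_onD_Icc'[OF this, of c] show ?thesis using assms by simp
qed

text \<open>A nonpositive exponent makes the power convex. The use is \<open>p = - \<kappa>\<close>,
  as \<open>(b / x) powr \<kappa>\<close> is a multiple of \<open>x powr - \<kappa>\<close>.\<close>

lemma powr_neg_chord_ge:
  fixes c x y p :: real
  assumes "0 < x" "x \<le> c" "c \<le> y" "p \<le> 0"
  shows "c powr p \<le> (y powr p - x powr p) / (y - x) * (c - x) + x powr p"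
proof -
  have "convex_on {0<..} (\<lambda>x::real. x powr p)"
  proof (rule f''_ge0_imp_convex)
    fix z :: real assume "z \<in> {0<..}"
    then have z: "0 < z" by simp
    show "((\<lambda>x. x powr p) has_real_derivative p * z powr (p - 1)) (at z)"
      using z by (auto intro!: derivative_eq_intros)
    show "((\<lambda>x. p * x powr (p - 1)) has_real_derivative p * ((p - 1) * z powr (p - 1 - 1))) (at z)"
      using z by (auto intro!: derivative_eq_intros)
    show "0 \<le> p * ((p - 1) * z powr (p - 1 - 1))"
      using assms by (intro mult_nonpos_nonpos mult_nonpos_nonneg) auto
  qed simp
  then have "convex_on {x..y} (\<lambda>x. x powr p)"
    by (rule convex_on_subset) (use assms in auto)
  from convex_onD_Icc'[OF this, of c] show ?thesis using assms by simp
qed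

text \<open>The second-order cone constraints of \<open>V_check\<close> say \<open>u \<le> (x/b)\<^bsup>1/8\<^esup>\<close>, and \<open>\<kappa> \<le> 1/8\<close>.\<close>

lemma mem_V_check:
  assumes a: "0 \<le> a" and b: "0 < b" and xl: "0 < xl" and x: "b \<le> x" "xl \<le> x" "x \<le> xu"
    and y: "y = a * ((x / b) powr \<kappa> - 1)"
  shows "(x, y, 1) \<in> V_check a b xl xu"
proof -
  define z where "z = x / b"
  have z: "1 \<le> z" "x = b * z" using b x by (auto simp: z_def)
  \<comment> \<open>Dividing the chord inequality for \<open>x powr \<kappa>\<close> by
    \<open>b powr \<kappa>\<close> gives the one for \<open>x / b\<close>. In the degenerate case
    \<open>xl = xu\<close> the slope is 0 and \<open>x = xl\<close>.\<close>
  have "\<sigma>V b xl xu * (x - xl) + (xl / b) powr \<kappa> \<le> (x / b) powr \<kappa>"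
  proof (cases "xl = xu")
    case False
    have "(xu powr \<kappa> - xl powr \<kappa>) / (xu - xl) * (x - xl) + xl powr \<kappa> \<le> x powr \<kappa>"
      using xl x by (intro powr_chord_le) auto
    then have "((xu powr \<kappa> - xl powr \<kappa>) / (xu - xl) * (x - xl) + xl powr \<kappa>) / b powr \<kappa>
        \<le> x powr \<kappa> / b powr \<kappa>"
      by (rule divide_right_mono) simp
    moreover have "((X - Y) / d * e + Y) / B = (X / B - Y / B) / d * e + Y / B" for X Y d e B :: real
      by (simp add: add_divide_distrib diff_divide_distrib[symmetric] mult.commute)
    ultimately show ?thesis using False xl x b by (simp add: \<sigma>V_def powr_divide)
  qed (use x in \<open>simp add: \<sigma>V_def\<close>)
  then have "a * (\<sigma>V b xl xu * (x - xl) + (xl / b) powr \<kappa>) \<le> a * (x / b) powr \<kappa>"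
    using a by (rule mult_left_mono)
  then have chord: "a * \<sigma>V b xl xu * (x - xl) + a * ((xl / b) powr \<kappa> - 1) \<le> y"
    by (simp add: y algebra_simps)
  \<comment> \<open>As \<open>1 \<le> z\<close> and \<open>2 * \<kappa> \<le> 1/4\<close>, the exact
    power fits the first cone constraint. With \<open>v1 = z powr (1/4)\<close> and
    \<open>v2 = z powr (1/2)\<close> the other two are equalities.\<close>
  have "(z powr \<kappa>)\<^sup>2 \<le> z powr (1/4)"
    using z by (simp add: power2_eq_square powr_add[symmetric] powr_mono)
  moreover have "(z powr (1/4))\<^sup>2 = z powr (1/2)" "b * (z powr (1/2))\<^sup>2 = x"
    using z by (simp_all add: power2_eq_square powr_add[symmetric])
  moreover have "1 \<le> z powr \<kappa>" using z by (simp add: ge_one_powr_ge_zero)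
  moreover have "0 \<le> y" using \<open>1 \<le> z powr \<kappa>\<close> a by (simp add: y z_def)
  ultimately have "\<exists>u v1 v2. 0 \<le> u \<and> 0 \<le> v1 \<and> 0 \<le> v2 \<and>
      u\<^sup>2 \<le> 1 * v1 \<and> v1\<^sup>2 \<le> 1 * v2 \<and> b * v2\<^sup>2 \<le> 1 * x \<and> y = a * (u - 1)"
    by (intro exI[of _ "z powr \<kappa>"] exI[of _ "z powr (1/4)"] exI[of _ "z powr (1/2)"])
      (simp only: y z_def powr_ge_zero; simp)
  with \<open>0 \<le> y\<close> show ?thesis
    unfolding V_check_def using b x chord by auto
qed

text \<open>The second-order cone constraints of \<open>W_check\<close> say \<open>u \<ge> (b/x)\<^bsup>1/9\<^esup>\<close>, and \<open>1/9 \<le> \<kappa>\<close>.\<close>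

lemma mem_W_check:
  assumes a: "0 \<le> a" and b: "0 < b" and xl: "0 < xl" and x: "x \<le> b" "xl \<le> x" "x \<le> xu"
    and y: "y = a * ((b / x) powr \<kappa> - 1)"
  shows "(x, y, 1) \<in> W_check a b xl xu"
proof -
  define z where "z = b / x"
  have z: "1 \<le> z" "b = x * z" using xl x by (auto simp: z_def)
  have "(b / x) powr \<kappa> \<le> \<sigma>W b xl xu * (x - xl) + (b / xl) powr \<kappa>"
  proof (cases "xl = xu")
    case False
    have "x powr - \<kappa> \<le> (xu powr - \<kappa> - xl powr - \<kappa>) / (xu - xl) * (x - xl) + xl powr - \<kappa>"
      using xl x by (intro powr_neg_chord_ge) auto
    then have scaled: "b powr \<kappa> * x powr - \<kappa>
        \<le> b powr \<kappa> * ((xu powr - \<kappa> - xl powr - \<kappa>) / (xu - xl) * (x - xl) + xl powr - \<kappa>)"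
      by (rule mult_left_mono) simp
    have distrib: "B * ((X - Y) / d * e + Y) = (B * X - B * Y) / d * e + B * Y" for X Y d e B :: real
      by (simp add: distrib_left right_diff_distrib[symmetric])
    have "b powr \<kappa> * t powr - \<kappa> = (b / t) powr \<kappa>" if "0 < t" for t
      using that b by (simp add: powr_divide powr_minus_divide)
    from this[of x] this[of xl] this[of xu] show ?thesis
      using scaled[unfolded distrib] False xl x by (simp add: \<sigma>W_def)
  qed (use x in \<open>simp add: \<sigma>W_def\<close>)
  then have "a * (b / x) powr \<kappa> \<le> a * (\<sigma>W b xl xu * (x - xl) + (b / xl) powr \<kappa>)"
    using a by (rule mult_left_mono)
  then have chord: "y \<le> a * \<sigma>W b xl xu * (x - xl) + a * ((b / xl) powr \<kappa> - 1)"
    by (simp add: y algebra_simps)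
  have sq: "(z powr - \<kappa>)\<^sup>2 = z powr (- 2 * \<kappa>)" "(z powr (- 2 * \<kappa>))\<^sup>2 = z powr (- 4 * \<kappa>)"
    "z powr \<kappa> * z powr - \<kappa> = 1"
    using z by (simp_all add: power2_eq_square powr_add[symmetric])
  \<comment> \<open>Powers of \<open>z\<close> with exponents \<open>\<kappa>\<close>,
    \<open>- \<kappa>\<close>, \<open>- 2 * \<kappa>\<close>, \<open>- 4 * \<kappa>\<close> make the
    first three cone constraints equalities. The last one, divided by \<open>x\<close>, compares the
    exponents \<open>1 - 8 * \<kappa>\<close> and \<open>\<kappa>\<close>; here
    \<open>1 \<le> 9 * \<kappa>\<close> enters.\<close>
  have "z * (z powr (- 4 * \<kappa>))\<^sup>2 = z powr (1 - 8 * \<kappa>)"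
    using z by (simp add: power2_eq_square powr_add[symmetric] powr_mult_base)
  also have "\<dots> \<le> z powr \<kappa>" using z by (intro powr_mono) auto
  finally have "x * (z * (z powr (- 4 * \<kappa>))\<^sup>2) \<le> x * z powr \<kappa>"
    using xl x by (intro mult_left_mono) auto
  then have bx: "b * (z powr (- 4 * \<kappa>))\<^sup>2 \<le> z powr \<kappa> * x"
    unfolding z(2) by (simp only: mult.assoc mult.commute)
  have "1 \<le> z powr \<kappa>" using z by (simp add: ge_one_powr_ge_zero)
  then have "0 \<le> y" using a by (simp add: y z_def)
  then have "\<exists>u v1 v2 v3. 0 \<le> u \<and> 0 \<le> v1 \<and> 0 \<le> v2 \<and> 0 \<le> v3 \<and>
      u * v1 \<ge> 1\<^sup>2 \<and> 1 * v2 \<ge> v1\<^sup>2 \<and> 1 * v3 \<ge> v2\<^sup>2 \<and> u * x \<ge> b * v3\<^sup>2 \<and> y = a * (u - 1)"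
    using sq bx by (intro exI[of _ "z powr \<kappa>"] exI[of _ "z powr - \<kappa>"]
        exI[of _ "z powr (- 2 * \<kappa>)"] exI[of _ "z powr (- 4 * \<kappa>)"])
      (simp only: y z_def powr_ge_zero; simp)
  with \<open>0 \<le> y\<close> show ?thesis
    unfolding W_check_def using xl x chord by auto
qed

text \<open>A piece with multiplier 0 takes the zero vector whatever its bounds, even when
  \<open>xl > xu\<close>. So a point can be placed in a single piece while the others stay
  idle.\<close>

lemma zero_mem_V_check: "(0, 0, 0) \<in> V_check a b xl xu"
  unfolding V_check_def mem_Collect_eq case_prod_conv
  by (intro conjI exI[of _ 0]) simp_all

lemma zero_mem_W_check: "(0, 0, 0) \<in> W_check a b xl xu"
  unfolding W_check_def mem_Collect_eq case_prod_conv
  by (intro conjI exI[of _ 0]) simp_all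

text \<open>The ratio bounds turn into the interval used in \<open>Y_set\<close>, and
  \<open>rl > 1\<close> yields the condition \<open>b \<le> x\<close> of
  \<open>mem_V_check\<close>.\<close>

lemma mem_V_check_ratio:
  assumes "0 \<le> a" "0 < b" "1 < rl" "0 < lo" "lo \<le> x" "x \<le> hi" "rl \<le> x / b" "x / b \<le> ru"
    and "y = a * ((x / b) powr \<kappa> - 1)"
  shows "(x, y, 1) \<in> V_check a b (max lo (b * rl)) (min hi (b * ru))"
proof (rule mem_V_check)
  have "b * 1 \<le> b * rl" "b * rl \<le> x" "x \<le> b * ru"
    using assms by (simp_all add: field_simps)
  then have "b \<le> x" "b * rl \<le> x" "x \<le> b * ru" by linarith+
  then show "b \<le> x" "max lo (b * rl) \<le> x" "x \<le> min hi (b * ru)" using assms by auto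
qed (use assms in auto)

text \<open>The ratio now decreases in \<open>x\<close>, so \<open>ru\<close> gives the lower end
  and \<open>rl\<close> the upper one; \<open>rl > 1\<close> yields
  \<open>x \<le> b\<close>.\<close>

lemma mem_W_check_ratio:
  assumes "0 \<le> a" "0 < b" "1 < rl" "0 < lo" "lo \<le> x" "x \<le> hi" "rl \<le> b / x" "b / x \<le> ru"
    and "y = a * ((b / x) powr \<kappa> - 1)"
  shows "(x, y, 1) \<in> W_check a b (max lo (b / ru)) (min hi (b / rl))"
proof (rule mem_W_check)
  have x: "0 < x" "0 < ru" using assms by linarith+
  then have "x * 1 \<le> x * rl" "x * rl \<le> b" "b \<le> x * ru"
    using assms x by (simp_all add: field_simps)
  then have "x \<le> b" "b / ru \<le> x" "x \<le> b / rl"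
    using assms x by (linarith, simp_all add: field_simps)
  then show "x \<le> b" "max lo (b / ru) \<le> x" "x \<le> min hi (b / rl)" using assms by auto
qed (use assms in auto)

section \<open>Convex combinations along rays and in the flow\<close>

text \<open>The common ratio \<open>\<pi>j / \<pi>i\<close> along a ray through the origin keeps the loss per unit flow
  constant, so a point of the box may be replaced by the two points where its ray meets the boundary.\<close>

lemma ray_boundary_convex:
  fixes C :: "real5 set"
  assumes C: "convex C"
    and box: "0 < pil" "pil \<le> p" "p \<le> piu" "0 < pjl" "pjl \<le> q" "q \<le> pju"
    and bd: "\<And>s. 0 < s \<Longrightarrow> pil \<le> s * p \<Longrightarrow> s * p \<le> piu \<Longrightarrow> pjl \<le> s * q \<Longrightarrow> s * q \<le> pju \<Longrightarrow>
      s * p = pil \<or> s * p = piu \<or> s * q = pjl \<or> s * q = pju \<Longrightarrow> (s * p, s * q, f, l, x) \<in> C"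
  shows "(p, q, f, l, x) \<in> C"
proof -
  \<comment> \<open>\<open>s\<close> and \<open>t\<close> are the least and the greatest scaling
    that keep the point in the box.\<close>
  define s where "s = max (pil / p) (pjl / q)"
  define t where "t = min (piu / p) (pju / q)"
  have pq: "0 < p" "0 < q" using box by linarith+
  have s: "0 < s" "s \<le> 1" "pil \<le> s * p" "pjl \<le> s * q" "s * p = pil \<or> s * q = pjl"
    using box pq by (auto simp: s_def max_def field_simps)
  have t: "1 \<le> t" "t * p \<le> piu" "t * q \<le> pju" "t * p = piu \<or> t * q = pju"
    using box pq by (auto simp: t_def min_def field_simps)
  have "s * p \<le> 1 * p" "s * q \<le> 1 * q" "1 * p \<le> t * p" "1 * q \<le> t * q"
    using s t pq by (auto intro!: mult_right_mono)
  then have "s * p \<le> piu" "s * q \<le> pju" "pil \<le> t * p" "pjl \<le> t * q" "0 < t"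
    using box t by linarith+
  then have st: "(s * p, s * q, f, l, x) \<in> C" "(t * p, t * q, f, l, x) \<in> C"
    using s t by (intro bd; blast)+
  show ?thesis
  \<comment> \<open>If \<open>s = t\<close>, both are 1 and the point itself lies on the boundary;
    otherwise \<open>r\<close> is chosen to make the mixed scaling equal to 1.\<close>
  proof (cases "s = t")
    case True
    then have "s = 1" using s t by simp
    then show ?thesis using st by simp
  next
    case False
    define r where "r = (1 - s) / (t - s)"
    have r: "0 \<le> r" "r \<le> 1" using s t False by (auto simp: r_def field_simps)
    have "r * (t - s) = 1 - s" using False by (simp add: r_def)
    then have rst: "(1 - r) * s + r * t = 1" by (simp add: algebra_simps)
    have "(1 - r) *\<^sub>R (s * p, s * q, f, l, x) + r *\<^sub>R (t * p, t * q, f, l, x) \<in> C"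
      using r by (intro convexD_alt[OF C st]) auto
    moreover have "(1 - r) * (s * c) + r * (t * c) = c" for c
      using arg_cong[OF rst, of "\<lambda>u. u * c"] by (simp add: algebra_simps)
    moreover have "(1 - r) * c + r * c = c" for c by (simp add: algebra_simps)
    ultimately show ?thesis by simp
  qed
qed

text \<open>With \<open>c\<close> fixed the loss is linear in the flow, and the weight is
  \<open>f / F\<close>. Bounding this quotient instead of ordering \<open>f\<close> and
  \<open>F\<close> also covers negative \<open>F\<close>.\<close>

lemma segment_to_zero_flow_convex:
  fixes C :: "real5 set"
  assumes C: "convex C" "(p, q, 0, 0, x) \<in> C" "(p, q, F, c * F, x) \<in> C"
    and "0 \<le> f / F" "f / F \<le> 1" "F \<noteq> 0"
  shows "(p, q, f, c * f, x) \<in> C"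
proof -
  have "(1 - f / F) *\<^sub>R (p, q, 0, 0, x) + (f / F) *\<^sub>R (p, q, F, c * F, x) \<in> C"
    using assms by (intro convexD_alt) auto
  moreover have "(1 - f / F) *\<^sub>R (p, q, 0, 0, x) + (f / F) *\<^sub>R (p, q, F, c * F, x) = (p, q, f, c * f, x)"
    using assms(6) by (simp add: field_simps)
  ultimately show ?thesis by simp
qed

lemma proj_memI: "((p, q, f, l, x, xp, xm), z) \<in> A \<Longrightarrow> (p, q, f, l, x) \<in> proj ` A"
  by (rule image_eqI) (simp_all add: proj_def)

section \<open>Covering the compression set by the pieces\<close>

context
  fixes pil piu pjl pju fl fu rl ru H :: real
  assumes pos: "0 < pil" "pil \<le> piu" "0 < pjl" "pjl \<le> pju" "fl < 0" "0 < fu" "1 < rl" "rl < ru" "0 < H"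
begin

abbreviation (input) Y where "Y \<equiv> Y_set pil piu pjl pju fl fu rl ru H"

lemma L_zero_subset: "L_zero pil piu pjl pju \<subseteq> proj ` Y"
proof clarify
  fix p q f l x assume "(p, q, f, l, x) \<in> L_zero pil piu pjl pju"
  then have "pil \<le> p" "p \<le> piu" "pjl \<le> q" "q \<le> pju" and 0: "f = 0" "l = 0" "x = 0"
    by (auto simp: L_zero_def)
  \<comment> \<open>The whole point goes into piece 0 with multiplier 1; \<open>axis\<close> puts 0
    in the entries of all other pieces.\<close>
  then have "((p, q, 0, 0, 0, 0, 0), axis Zero p, axis Zero q, axis Zero 0, axis Zero 0, axis Zero 1) \<in> Y"
    using pos by (simp add: Y_set_def axis_def zero_mem_V_check zero_mem_W_check)
  then show "(p, q, f, l, x) \<in> proj ` Y" unfolding 0 by (rule proj_memI)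
qed

lemma idle_plus_mem:
  assumes "(p, q) \<in> Pi_plus pil piu pjl pju rl ru"
  shows "(p, q, 0, 0, 1) \<in> proj ` Y"
proof -
  have pq: "pil \<le> p" "p \<le> piu" "pjl \<le> q" "q \<le> pju"
    using assms by (auto simp: Pi_plus_def)
  have "0 < p" "0 < q" using pos pq by linarith+
  then have "rl * p \<le> q" "q \<le> ru * p" using assms by (auto simp: Pi_plus_def field_simps)
  then have "((p, q, 0, 0, 1, 1, 0), axis Pos1 p, axis Pos1 q, axis Pos1 0, axis Pos1 0, axis Pos1 1) \<in> Y"
    using pq pos by (simp add: Y_set_def axis_def zero_mem_V_check zero_mem_W_check)
  then show ?thesis by (rule proj_memI)
qed

text \<open>Fixing \<open>p\<close> makes the loss concave in \<open>q\<close>, hence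
  \<open>V_check\<close>; fixing \<open>q\<close> makes it convex in \<open>p\<close>, hence
  \<open>W_check\<close>. Both memberships are shown at a general point, and the edge then selects
  the piece.\<close>

lemma boundary_plus_mem:
  assumes "(p, q) \<in> Pi_plus pil piu pjl pju rl ru" "p = pil \<or> p = piu \<or> q = pjl \<or> q = pju"
    and "l = H * ((q / p) powr \<kappa> - 1) * fu"
  shows "(p, q, fu, l, 1) \<in> proj ` Y"
proof -
  have pq: "pil \<le> p" "p \<le> piu" "pjl \<le> q" "q \<le> pju" "rl \<le> q / p" "q / p \<le> ru"
    using assms(1) by (auto simp: Pi_plus_def)
  have l: "l = H * fu * ((q / p) powr \<kappa> - 1)" using assms(3) by simp
  have "0 < p" "0 < q" using pos pq by linarith+
  have V: "(q, l, 1) \<in> V_check (H * fu) p (max pjl (p * rl)) (min pju (p * ru))"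
    by (rule mem_V_check_ratio[OF _ \<open>0 < p\<close> pos(7,3) pq(3-6) l]) (use pos in simp)
  have W: "(p, l, 1) \<in> W_check (H * fu) q (max pil (q / ru)) (min piu (q / rl))"
    by (rule mem_W_check_ratio[OF _ \<open>0 < q\<close> pos(7,1) pq(1,2,5,6) l]) (use pos in simp)
  have "\<exists>k. ((p, q, fu, l, 1, 1, 0), axis k p, axis k q, axis k fu, axis k l, axis k 1) \<in> Y"
    using assms(2)
  proof (elim disjE)
    assume "p = pil"
    then show ?thesis using V pq pos
      by (intro exI[of _ Pos2]) (simp add: Y_set_def axis_def zero_mem_V_check zero_mem_W_check)
  next
    assume "p = piu"
    then show ?thesis using V pq pos
      by (intro exI[of _ Pos3]) (simp add: Y_set_def axis_def zero_mem_V_check zero_mem_W_check)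
  next
    assume "q = pjl"
    then show ?thesis using W pq pos
      by (intro exI[of _ Pos4]) (simp add: Y_set_def axis_def zero_mem_V_check zero_mem_W_check)
  next
    assume "q = pju"
    then show ?thesis using W pq pos
      by (intro exI[of _ Pos5]) (simp add: Y_set_def axis_def zero_mem_V_check zero_mem_W_check)
  qed
  then show ?thesis by (elim exE) (rule proj_memI)
qed

lemma idle_minus_mem:
  assumes "(p, q) \<in> Pi_minus pil piu pjl pju rl ru"
  shows "(p, q, 0, 0, 1) \<in> proj ` Y"
proof -
  have pq: "pil \<le> p" "p \<le> piu" "pjl \<le> q" "q \<le> pju"
    using assms by (auto simp: Pi_minus_def)
  have "0 < p" "0 < q" using pos pq by linarith+
  then have "rl * q \<le> p" "p \<le> ru * q" using assms by (auto simp: Pi_minus_def field_simps)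
  then have "((p, q, 0, 0, 1, 0, 1), axis Neg1 p, axis Neg1 q, axis Neg1 0, axis Neg1 0, axis Neg1 1) \<in> Y"
    using pq pos by (simp add: Y_set_def axis_def zero_mem_V_check zero_mem_W_check)
  then show ?thesis by (rule proj_memI)
qed

text \<open>The pressures exchange roles, and as \<open>fl < 0\<close> the check sets are used with
  \<open>- l\<close> and the nonnegative factor \<open>- H * fl\<close>.\<close>

lemma boundary_minus_mem:
  assumes "(p, q) \<in> Pi_minus pil piu pjl pju rl ru" "p = pil \<or> p = piu \<or> q = pjl \<or> q = pju"
    and "l = H * ((p / q) powr \<kappa> - 1) * fl"
  shows "(p, q, fl, l, 1) \<in> proj ` Y"
proof -
  have pq: "pil \<le> p" "p \<le> piu" "pjl \<le> q" "q \<le> pju" "rl \<le> p / q" "p / q \<le> ru"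
    using assms(1) by (auto simp: Pi_minus_def)
  have l: "- l = - H * fl * ((p / q) powr \<kappa> - 1)" using assms(3) by simp
  have a: "0 \<le> - H * fl" using pos by (simp add: mult_nonneg_nonpos)
  have "0 < p" "0 < q" using pos pq by linarith+
  have V: "(p, - l, 1) \<in> V_check (- H * fl) q (max pil (q * rl)) (min piu (q * ru))"
    by (rule mem_V_check_ratio[OF a \<open>0 < q\<close> pos(7,1) pq(1,2,5,6) l])
  have W: "(q, - l, 1) \<in> W_check (- H * fl) p (max pjl (p / ru)) (min pju (p / rl))"
    by (rule mem_W_check_ratio[OF a \<open>0 < p\<close> pos(7,3) pq(3-6) l])
  have "\<exists>k. ((p, q, fl, l, 1, 0, 1), axis k p, axis k q, axis k fl, axis k l, axis k 1) \<in> Y"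
    using assms(2)
  proof (elim disjE)
    assume "q = pjl"
    then show ?thesis using V pq pos
      by (intro exI[of _ Neg2]) (simp add: Y_set_def axis_def zero_mem_V_check zero_mem_W_check)
  next
    assume "q = pju"
    then show ?thesis using V pq pos
      by (intro exI[of _ Neg3]) (simp add: Y_set_def axis_def zero_mem_V_check zero_mem_W_check)
  next
    assume "p = pil"
    then show ?thesis using W pq pos
      by (intro exI[of _ Neg4]) (simp add: Y_set_def axis_def zero_mem_V_check zero_mem_W_check)
  next
    assume "p = piu"
    then show ?thesis using W pq pos
      by (intro exI[of _ Neg5]) (simp add: Y_set_def axis_def zero_mem_V_check zero_mem_W_check)
  qed
  then show ?thesis by (elim exE) (rule proj_memI)
qed

lemma L_plus_subset:
  assumes "convex (proj ` Y)"
  shows "L_plus pil piu pjl pju fu rl ru H \<subseteq> proj ` Y"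
proof clarify
  fix p q f l x assume "(p, q, f, l, x) \<in> L_plus pil piu pjl pju fu rl ru H"
  then have x: "x = 1" and l: "l = H * ((q / p) powr \<kappa> - 1) * f"
    and pq: "(p, q) \<in> Pi_plus pil piu pjl pju rl ru" and f: "0 \<le> f" "f \<le> fu"
    by (auto simp: L_plus_def)
  have full: "(p, q, fu, H * ((q / p) powr \<kappa> - 1) * fu, 1) \<in> proj ` Y"
  proof (rule ray_boundary_convex[OF assms])
    fix s assume s: "0 < s" "pil \<le> s * p" "s * p \<le> piu" "pjl \<le> s * q" "s * q \<le> pju"
      and bd: "s * p = pil \<or> s * p = piu \<or> s * q = pjl \<or> s * q = pju"
    \<comment> \<open>The scaling cancels in the ratio, so the ratio bounds and the loss carry
      over.\<close>
    from s show "(s * p, s * q, fu, H * ((q / p) powr \<kappa> - 1) * fu, 1) \<in> proj ` Y"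
      using pq by (intro boundary_plus_mem[OF _ bd]) (simp_all add: Pi_plus_def)
  qed (use pos pq in \<open>simp_all add: Pi_plus_def\<close>)
  show "(p, q, f, l, x) \<in> proj ` Y"
    unfolding x l
    by (rule segment_to_zero_flow_convex[OF assms idle_plus_mem[OF pq] full]) (use pos f in simp_all)
qed

lemma L_minus_subset:
  assumes "convex (proj ` Y)"
  shows "L_minus pil piu pjl pju fl rl ru H \<subseteq> proj ` Y"
proof clarify
  fix p q f l x assume "(p, q, f, l, x) \<in> L_minus pil piu pjl pju fl rl ru H"
  then have x: "x = 1" and l: "l = H * ((p / q) powr \<kappa> - 1) * f"
    and pq: "(p, q) \<in> Pi_minus pil piu pjl pju rl ru" and f: "fl \<le> f" "f \<le> 0"
    by (auto simp: L_minus_def)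
  have full: "(p, q, fl, H * ((p / q) powr \<kappa> - 1) * fl, 1) \<in> proj ` Y"
  proof (rule ray_boundary_convex[OF assms])
    fix s assume s: "0 < s" "pil \<le> s * p" "s * p \<le> piu" "pjl \<le> s * q" "s * q \<le> pju"
      and bd: "s * p = pil \<or> s * p = piu \<or> s * q = pjl \<or> s * q = pju"
    from s show "(s * p, s * q, fl, H * ((p / q) powr \<kappa> - 1) * fl, 1) \<in> proj ` Y"
      using pq by (intro boundary_minus_mem[OF _ bd]) (simp_all add: Pi_minus_def)
  qed (use pos pq in \<open>simp_all add: Pi_minus_def\<close>)
  \<comment> \<open>\<open>f\<close> and \<open>fl\<close> are both nonpositive, so the weight
    \<open>f / fl\<close> lies between 0 and 1.\<close>
  show "(p, q, f, l, x) \<in> proj ` Y"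
    unfolding x l
    by (rule segment_to_zero_flow_convex[OF assms idle_minus_mem[OF pq] full])
      (use pos f in \<open>simp_all add: zero_le_divide_iff divide_le_eq_1\<close>)
qed

end

theorem theorem3:
  fixes pil piu pjl pju fl fu rl ru H :: real
  assumes "0 < pil" "pil \<le> piu"
    and "0 < pjl" "pjl \<le> pju"
    and "fl < 0" "0 < fu"
    and "1 < rl" "rl < ru"
    and "0 < H"
  shows "SOCr (Y_set pil piu pjl pju fl fu rl ru H) \<and>
    SOCr (proj ` Y_set pil piu pjl pju fl fu rl ru H) \<and>
    convex hull (compression_set pil piu pjl pju fl fu rl ru H)
      \<subseteq> proj ` Y_set pil piu pjl pju fl fu rl ru H"
proof -
  have Y: "SOCr (Y_set pil piu pjl pju fl fu rl ru H)"
    using assms by (intro SOCr_Y_set) auto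
  then have proj: "SOCr (proj ` Y_set pil piu pjl pju fl fu rl ru H)"
    by (rule SOCr_linear_image[OF _ linear_proj])
  \<comment> \<open>Representability includes convexity, so the hull inclusion reduces to the
    inclusions of the three parts.\<close>
  then have convex: "convex (proj ` Y_set pil piu pjl pju fl fu rl ru H)"
    by (simp add: SOCr_def)
  then have "convex hull (compression_set pil piu pjl pju fl fu rl ru H)
      \<subseteq> proj ` Y_set pil piu pjl pju fl fu rl ru H"
    unfolding compression_set_def
    by (intro hull_minimal Un_least L_plus_subset L_minus_subset L_zero_subset assms)
  with Y proj show ?thesis by blast
qed

end
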